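(* It holds that: (1) $(\mathcal{K}^\bullet)^\circ=\mathcal{K}$ for every coherent set of strictly desirable gambles (SDG) $\mathcal{K}\subseteq\mathbb{C}_h^{n\times n}$; and (2) $(\mathcal{M}^\circ)^\bullet=\mathcal{M}$ for every quantum credal set $\mathcal{M}\subseteq\mathcal{D}_h^{n\times n}$. Any SDG is in correspondence with a closed convex set of density matrices and vice versa.
   Context: $\mathbb{C}_h^{n\times n}$ is the real vector space of $n\times n$ complex Hermitian matrices, with inner product $G\cdot R=\mathrm{Tr}(G^\dagger R)$. For $G\in\mathbb{C}_h^{n\times n}$: $G\geq 0$ means positive semi-definite; $G\gneq 0$ means $G\ge 0$ and $G\ne 0$; $G>0$ means positive definite. $\mathcal{D}_h^{n\times n}=\{R\in\mathbb{C}_h^{n\times n}\mid R\ge 0,\ \mathrm{Tr}(R)=1\}$ is the set of density matrices. A set $\mathcal{K}\subseteq\mathbb{C}_h^{n\times n}$ is a coherent set of strictly desirable gambles (SDG) if: (S1) $\mathcal{K}$ is a non-pointed convex cone, i.e. closed under addition and under multiplication by reals $\nu>0$, and $0\notin\mathcal{K}$; (S2) every $G\gneq 0$ belongs to $\mathcal{K}$; (S3) if $G\in\mathcal{K}$ then either $G\gneq 0$ or $G-\Delta\in\mathcal{K}$ for some $\Delta\in\mathbb{C}_h^{n\times n}$ with $\Delta>0$. For an SDG $\mathcal{K}$, its (normalised) dual is $\mathcal{K}^\bullet=\{\rho\in\mathcal{D}_h^{n\times n}\mid \forall G\in\mathcal{K}:\ G\gneq 0\ \text{or}\ G\cdot\rho>0\}$,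 which equals $\{\rho\in\mathcal{D}_h^{n\times n}\mid G\cdot\rho\ge 0\ \forall G\in\mathcal{K}\}$. A quantum credal set is a set of the form $\mathcal{K}^\bullet$ with $\mathcal{K}$ an SDG. For a set $\mathcal{M}$ of density matrices, $\mathcal{M}^\circ=\{G\in\mathbb{C}_h^{n\times n}\mid G\gneq 0\}\cup\{G\in\mathbb{C}_h^{n\times n}\mid G\cdot\rho>0\ \forall\rho\in\mathcal{M}\}$. The maps $\mathcal{K}\mapsto\mathcal{K}^\bullet$ and $\mathcal{M}\mapsto\mathcal{M}^\circ$ are the correspondence referred to in the last sentence of the claim. *)

theory Defs
  imports "HOL-Analysis.Analysis"
begin

definition mat_adjoint :: "complex ^ 'n ^ 'm \<Rightarrow> complex ^ 'm ^ 'n" where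
  "mat_adjoint A = (\<chi> i j. cnj (A $ j $ i))"

definition hermitian :: "complex ^ 'n ^ 'n \<Rightarrow> bool" where
  "hermitian A \<longleftrightarrow> mat_adjoint A = A"

text \<open>For Hermitian arguments the trace below is already real (lemma \<open>hs_inner_hermitian\<close>),
  so taking the real part only changes the type. The same holds for \<open>qform\<close>, the form
  \<open>v \<mapsto> v\<^sup>* A v\<close> (lemma \<open>qform_hermitian\<close>).\<close>

definition hs_inner :: "complex ^ 'n ^ 'n \<Rightarrow> complex ^ 'n ^ 'n \<Rightarrow> real" where
  "hs_inner G R = Re (trace (mat_adjoint G ** R))"

definition qform :: "complex ^ 'n ^ 'n \<Rightarrow> complex ^ 'n \<Rightarrow> real" where
  "qform A v = Re (\<Sum>i\<in>UNIV. cnj (v $ i) * (A *v v) $ i)"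

lemma hs_inner_hermitian:
  assumes "hermitian G" "hermitian R"
  shows "complex_of_real (hs_inner G R) = trace (mat_adjoint G ** R)"
proof -
  have G: "cnj (G $ i $ j) = G $ j $ i" and R: "cnj (R $ i $ j) = R $ j $ i" for i j
    using assms unfolding hermitian_def mat_adjoint_def vec_eq_iff by auto
  have t: "trace (mat_adjoint G ** R) = (\<Sum>i\<in>UNIV. \<Sum>k\<in>UNIV. G $ i $ k * R $ k $ i)"
    by (simp add: trace_def matrix_matrix_mult_def mat_adjoint_def G)
  have "cnj (trace (mat_adjoint G ** R)) = (\<Sum>i\<in>UNIV. \<Sum>k\<in>UNIV. G $ k $ i * R $ i $ k)"
    by (simp add: t G R)
  also have "\<dots> = trace (mat_adjoint G ** R)"
    unfolding t by (rule sum.swap)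
  finally show ?thesis
    unfolding hs_inner_def by (metis Reals_cnj_iff of_real_Re)
qed

lemma qform_hermitian:
  assumes "hermitian A"
  shows "complex_of_real (qform A v) = (\<Sum>i\<in>UNIV. cnj (v $ i) * (A *v v) $ i)"
proof -
  have A: "cnj (A $ i $ j) = A $ j $ i" for i j
    using assms unfolding hermitian_def mat_adjoint_def vec_eq_iff by auto
  let ?s = "\<Sum>i\<in>UNIV. cnj (v $ i) * (A *v v) $ i"
  have s: "?s = (\<Sum>i\<in>UNIV. \<Sum>k\<in>UNIV. cnj (v $ i) * A $ i $ k * v $ k)"
    by (simp add: matrix_vector_mult_def sum_distrib_left mult.assoc)
  have "cnj ?s = (\<Sum>i\<in>UNIV. \<Sum>k\<in>UNIV. cnj (v $ k) * A $ k $ i * v $ i)"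
    unfolding s by (simp add: A mult_ac)
  also have "\<dots> = ?s"
    unfolding s by (rule sum.swap)
  finally show ?thesis
    unfolding qform_def by (metis Reals_cnj_iff of_real_Re)
qed

definition pos_semidef :: "complex ^ 'n ^ 'n \<Rightarrow> bool" where
  "pos_semidef A \<longleftrightarrow> hermitian A \<and> (\<forall>v. 0 \<le> qform A v)"

definition pos_semidef_nonzero :: "complex ^ 'n ^ 'n \<Rightarrow> bool" where
  "pos_semidef_nonzero A \<longleftrightarrow> pos_semidef A \<and> A \<noteq> 0"

definition pos_def :: "complex ^ 'n ^ 'n \<Rightarrow> bool" where
  "pos_def A \<longleftrightarrow> hermitian A \<and> (\<forall>v. v \<noteq> 0 \<longrightarrow> 0 < qform A v)"

definition density_matrices :: "(complex ^ 'n ^ 'n) set" where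
  "density_matrices = {R. pos_semidef R \<and> trace R = 1}"

text \<open>The library predicate \<open>cone\<close> is not used here, because it allows the factor zero
  and so puts the origin into every nonempty cone.\<close>

definition sdg :: "(complex ^ 'n ^ 'n) set \<Rightarrow> bool" where
  "sdg K \<longleftrightarrow>
     (\<forall>G\<in>K. hermitian G) \<and>
     (\<forall>G\<in>K. \<forall>H\<in>K. G + H \<in> K) \<and>
     (\<forall>G\<in>K. \<forall>\<nu>::real. 0 < \<nu> \<longrightarrow> \<nu> *\<^sub>R G \<in> K) \<and>
     0 \<notin> K \<and>
     (\<forall>G. pos_semidef_nonzero G \<longrightarrow> G \<in> K) \<and>
     (\<forall>G\<in>K. pos_semidef_nonzero G \<or> (\<exists>D. pos_def D \<and> G - D \<in> K))"

definition credal_of :: "(complex ^ 'n ^ 'n) set \<Rightarrow> (complex ^ 'n ^ 'n) set" where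
  "credal_of K =
     {\<rho> \<in> density_matrices. \<forall>G\<in>K. pos_semidef_nonzero G \<or> 0 < hs_inner G \<rho>}"

definition gambles_of :: "(complex ^ 'n ^ 'n) set \<Rightarrow> (complex ^ 'n ^ 'n) set" where
  "gambles_of M =
     {G. pos_semidef_nonzero G} \<union> {G. hermitian G \<and> (\<forall>\<rho>\<in>M. 0 < hs_inner G \<rho>)}"

definition quantum_credal_set :: "(complex ^ 'n ^ 'n) set \<Rightarrow> bool" where
  "quantum_credal_set M \<longleftrightarrow> (\<exists>K. sdg K \<and> M = credal_of K)"

text \<open>Nonemptiness cannot be dropped: \<open>gambles_of {}\<close> consists of all Hermitian matrices,
  so it contains \<open>0\<close> and is not an SDG. Closedness in the ambient matrix space agrees with
  closedness in the real subspace of Hermitian matrices, which is itself closed.\<close>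

definition closed_convex_density_set :: "(complex ^ 'n ^ 'n) set \<Rightarrow> bool" where
  "closed_convex_density_set M \<longleftrightarrow>
     M \<subseteq> density_matrices \<and> M \<noteq> {} \<and> closed M \<and> convex M"

end

(* Separating hyperplanes in the real Hilbert-Schmidt space, together with self-duality of the
   positive semidefinite cone. A Hermitian G outside an SDG K is separated from K by a functional
   that is nonnegative on all semidefinite matrices; normalising its trace gives an element of the
   dual with G . rho <= 0. Condition (S3) turns "nonnegative on K" into "positive on the
   non-semidefinite part of K", so the dual is closed. Conversely a density matrix outside a closed
   convex M is separated from M by some A, and subtracting the threshold times the identity
   makes A a gamble that is positive on M. Compactness of M yields (S3) for its gambles. *)

theory Submission
  imports Defs
begin

section \<open>Adjoints and Hermitian matrices\<close>

lemma mat_adjoint_nth [simp]: "mat_adjoint A $ i $ j = cnj (A $ j $ i)"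
  by (simp add: mat_adjoint_def)

lemma mat_adjoint_adjoint [simp]: "mat_adjoint (mat_adjoint A) = A"
  by (simp add: vec_eq_iff)

lemma mat_adjoint_add: "mat_adjoint (A + B) = mat_adjoint A + mat_adjoint B"
  by (simp add: vec_eq_iff)

lemma mat_adjoint_scaleR: "mat_adjoint (r *\<^sub>R A) = r *\<^sub>R mat_adjoint A"
  by (simp add: vec_eq_iff)

lemma mat_adjoint_diff: "mat_adjoint (A - B) = mat_adjoint A - mat_adjoint B"
  by (simp add: vec_eq_iff)

lemma mat_adjoint_mat_1: "mat_adjoint (mat 1 :: complex ^ 'n ^ 'n) = mat 1"
  by (simp add: vec_eq_iff mat_def)

lemma hermitian_iff: "hermitian A \<longleftrightarrow> (\<forall>i j. A $ i $ j = cnj (A $ j $ i))"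
  unfolding hermitian_def vec_eq_iff mat_adjoint_nth by metis

lemma hermitian_nth: "hermitian A \<Longrightarrow> A $ i $ j = cnj (A $ j $ i)"
  unfolding hermitian_iff by blast

lemma hermitian_add: "hermitian A \<Longrightarrow> hermitian B \<Longrightarrow> hermitian (A + B)"
  by (simp add: hermitian_def mat_adjoint_add)

lemma hermitian_diff: "hermitian A \<Longrightarrow> hermitian B \<Longrightarrow> hermitian (A - B)"
  by (simp add: hermitian_def mat_adjoint_diff)

lemma hermitian_scaleR: "hermitian A \<Longrightarrow> hermitian (r *\<^sub>R A)"
  by (simp add: hermitian_def mat_adjoint_scaleR)

lemma hermitian_mat_1: "hermitian (mat 1 :: complex ^ 'n ^ 'n)"
  by (simp add: hermitian_def mat_adjoint_mat_1)

lemma hermitian_add_mat_adjoint: "hermitian (A + mat_adjoint A)"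
  by (simp add: hermitian_def mat_adjoint_add)

section \<open>The Hilbert-Schmidt product as a Euclidean inner product\<close>

lemma inner_complex_eq: "z \<bullet> w = Re (cnj z * w)"
  by (simp add: inner_complex_def)

lemma inner_of_real_mult: "(complex_of_real r * z) \<bullet> z = r * (cmod z)\<^sup>2"
  using power2_norm_eq_inner[of z] by (simp flip: scaleR_conv_of_real)

text \<open>Both sides add up \<open>Re (cnj a * b)\<close> over all entries, in different orders.
  From here on the Euclidean theory of separation and compactness applies to the trace form.\<close>

lemma hs_inner_eq_inner: "hs_inner A B = A \<bullet> B"
proof -
  have "hs_inner A B = (\<Sum>i\<in>UNIV. \<Sum>k\<in>UNIV. (A $ k $ i) \<bullet> (B $ k $ i))"
    by (simp add: hs_inner_def trace_def matrix_matrix_mult_def inner_complex_eq)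
  also have "\<dots> = A \<bullet> B"
    unfolding inner_vec_def by (rule sum.swap)
  finally show ?thesis .
qed

lemma inner_mat_adjoint: "mat_adjoint A \<bullet> mat_adjoint B = A \<bullet> B"
proof -
  have "mat_adjoint A \<bullet> mat_adjoint B = (\<Sum>i\<in>UNIV. \<Sum>k\<in>UNIV. (A $ k $ i) \<bullet> (B $ k $ i))"
    by (simp add: inner_vec_def inner_complex_def)
  also have "\<dots> = A \<bullet> B"
    unfolding inner_vec_def by (rule sum.swap)
  finally show ?thesis .
qed

lemma inner_mat_1: "mat 1 \<bullet> (A :: complex ^ 'n ^ 'n) = Re (trace A)"
proof -
  have "(if i = j then 1 else 0) \<bullet> (A $ i $ j) = (if j = i then Re (A $ i $ i) else 0)" for i j
    by (simp add: inner_complex_def)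
  then show ?thesis
    by (simp add: inner_vec_def mat_def trace_def)
qed

section \<open>Rank-one matrices and quadratic forms\<close>

text \<open>The matrix \<open>v v\<^sup>*\<close>, which is the squared norm of \<open>v\<close>
  times the orthogonal projection onto its line when \<open>v\<close> is nonzero.\<close>

definition outer :: "complex ^ 'n \<Rightarrow> complex ^ 'n ^ 'n" where
  "outer v = (\<chi> i j. v $ i * cnj (v $ j))"

lemma qform_eq_inner_mult: "qform A v = v \<bullet> (A *v v)"
  by (simp add: qform_def inner_vec_def inner_complex_eq)

text \<open>Turns the form into a functional linear in \<open>A\<close>, so that membership in the
  semidefinite cone becomes a family of half-space conditions.\<close>

lemma qform_eq_inner_outer: "qform A v = A \<bullet> outer v"
proof -
  have "Re (cnj (v $ i) * (A $ i $ j * v $ j)) = (A $ i $ j) \<bullet> (v $ i * cnj (v $ j))" for i j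
    by (simp add: inner_complex_def algebra_simps)
  then show ?thesis
    by (simp add: qform_def inner_vec_def outer_def matrix_vector_mult_def sum_distrib_left)
qed

lemma hermitian_outer: "hermitian (outer v)"
  by (simp add: hermitian_iff outer_def)

lemma qform_outer: "qform (outer u) w = (cmod (\<Sum>j\<in>UNIV. cnj (w $ j) * u $ j))\<^sup>2"
proof -
  let ?s = "\<Sum>j\<in>UNIV. cnj (w $ j) * u $ j"
  have "(\<Sum>i\<in>UNIV. cnj (w $ i) * (outer u *v w) $ i) =
      (\<Sum>i\<in>UNIV. \<Sum>j\<in>UNIV. (cnj (w $ i) * u $ i) * cnj (cnj (w $ j) * u $ j))"
    by (simp add: matrix_vector_mult_def outer_def sum_distrib_left mult_ac)
  also have "\<dots> = ?s * cnj ?s"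
    by (simp only: sum_product cnj_sum)
  finally have "(\<Sum>i\<in>UNIV. cnj (w $ i) * (outer u *v w) $ i) = ?s * cnj ?s" .
  then show ?thesis
    unfolding qform_def by (simp only: complex_norm_square[symmetric] Re_complex_of_real)
qed

lemma pos_semidef_outer: "pos_semidef (outer v)"
  by (simp add: pos_semidef_def hermitian_outer qform_outer)

lemma qform_mat_1: "qform (mat 1) v = (norm v)\<^sup>2"
  by (simp add: qform_eq_inner_mult power2_norm_eq_inner)

lemma norm_outer: "norm (outer v) = (norm v)\<^sup>2"
proof -
  have "(norm (outer v))\<^sup>2 = qform (outer v) v"
    by (simp add: qform_eq_inner_outer power2_norm_eq_inner)
  also have "\<dots> = ((norm v)\<^sup>2)\<^sup>2"
  proof -
    have "(\<Sum>j\<in>UNIV. cnj (v $ j) * v $ j) = complex_of_real (v \<bullet> v)"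
      by (simp add: inner_vec_def complex_eq_iff inner_complex_def)
    then show ?thesis
      by (simp add: qform_outer power2_norm_eq_inner)
  qed
  finally show ?thesis
    by (rule power2_eq_imp_eq) simp_all
qed

text \<open>Cauchy-Schwarz against \<open>outer v\<close> replaces a bound by the largest
  eigenvalue.\<close>

lemma qform_le: "qform A v \<le> norm A * (norm v)\<^sup>2"
  using norm_cauchy_schwarz[of A "outer v"] by (simp add: qform_eq_inner_outer norm_outer)

lemma qform_add: "qform (A + B) v = qform A v + qform B v"
  by (simp add: qform_eq_inner_outer inner_add_left)

lemma qform_diff: "qform (A - B) v = qform A v - qform B v"
  by (simp add: qform_eq_inner_outer inner_diff_left)

lemma qform_scaleR: "qform (r *\<^sub>R A) v = r * qform A v"
  by (simp add: qform_eq_inner_outer)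

lemma hermitian_inner_mult:
  assumes "hermitian A"
  shows "x \<bullet> (A *v y) = (A *v x) \<bullet> y"
proof -
  note A = hermitian_nth[OF assms]
  have "x \<bullet> (A *v y) = (\<Sum>i\<in>UNIV. \<Sum>j\<in>UNIV. (x $ i) \<bullet> (A $ i $ j * y $ j))"
    by (simp add: inner_vec_def matrix_vector_mult_def inner_sum_right)
  also have "\<dots> = (\<Sum>j\<in>UNIV. \<Sum>i\<in>UNIV. (x $ i) \<bullet> (A $ i $ j * y $ j))"
    by (rule sum.swap)
  also have "\<dots> = (\<Sum>j\<in>UNIV. \<Sum>i\<in>UNIV. (A $ j $ i * x $ i) \<bullet> (y $ j))"
  proof (intro sum.cong refl)
    fix j i
    show "(x $ i) \<bullet> (A $ i $ j * y $ j) = (A $ j $ i * x $ i) \<bullet> (y $ j)"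
      by (subst A) (simp add: inner_complex_def algebra_simps)
  qed
  also have "\<dots> = (A *v x) \<bullet> y"
    by (simp add: inner_vec_def matrix_vector_mult_def inner_sum_left)
  finally show ?thesis .
qed

text \<open>Perturbing one coordinate changes the form by a quadratic polynomial. Special choices of
  \<open>w\<close> and \<open>c\<close> yield the sign of diagonal entries, the vanishing of rows
  and the pivot step.\<close>

lemma qform_add_axis:
  assumes "hermitian A"
  shows "qform A (w + axis i c) =
    qform A w + 2 * (c \<bullet> (A *v w) $ i) + (cmod c)\<^sup>2 * Re (A $ i $ i)"
proof -
  have "A $ i $ i = cnj (A $ i $ i)"
    using assms by (rule hermitian_nth)
  then have "Im (A $ i $ i) = 0"
    by (simp add: complex_eq_iff)
  have "(A *v axis i c) $ i = A $ i $ i * c"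
    by (simp add: matrix_vector_mult_def axis_def if_distrib cong: if_cong)
  then have "(A *v axis i c) $ i = complex_of_real (Re (A $ i $ i)) * c"
    using \<open>Im (A $ i $ i) = 0\<close> by (simp add: complex_eq_iff)
  then have *: "axis i c \<bullet> (A *v axis i c) = (cmod c)\<^sup>2 * Re (A $ i $ i)"
    by (simp add: inner_axis' inner_of_real_mult inner_commute[of c])
  have "w \<bullet> (A *v axis i c) = axis i c \<bullet> (A *v w)"
    by (metis assms hermitian_inner_mult inner_commute)
  then show ?thesis
    by (simp add: qform_eq_inner_mult matrix_vector_right_distrib inner_add_left inner_add_right *)
      (simp add: inner_axis')
qed

section \<open>The positive semidefinite cone and its self-duality\<close>

lemma pos_semidef_add: "pos_semidef A \<Longrightarrow> pos_semidef B \<Longrightarrow> pos_semidef (A + B)"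
  by (simp add: pos_semidef_def hermitian_add qform_add)

lemma pos_semidef_scaleR: "pos_semidef A \<Longrightarrow> 0 \<le> r \<Longrightarrow> pos_semidef (r *\<^sub>R A)"
  by (simp add: pos_semidef_def hermitian_scaleR qform_scaleR)

lemma pos_semidef_diag_nonneg:
  assumes "pos_semidef A"
  shows "0 \<le> Re (A $ i $ i)"
proof -
  have "0 \<le> qform A (0 + axis i 1)"
    using assms unfolding pos_semidef_def by blast
  also have "\<dots> = Re (A $ i $ i)"
    using assms by (subst qform_add_axis) (auto simp: pos_semidef_def qform_eq_inner_mult)
  finally show ?thesis .
qed

text \<open>With a zero diagonal entry the quadratic term of the perturbation disappears. What
  remains is affine in the size of the perturbation and nonnegative everywhere, so its slope is
  zero.\<close>

lemma pos_semidef_row_eq_0: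
  assumes "pos_semidef A" "Re (A $ i $ i) = 0"
  shows "A $ i $ j = 0"
proof -
  define w :: "complex ^ 'a" where "w = axis j 1"
  have Aw: "(A *v w) $ i = A $ i $ j"
    by (simp add: w_def matrix_vector_mult_def axis_def if_distrib cong: if_cong)
  have "0 \<le> qform A w + 2 * r * (cmod (A $ i $ j))\<^sup>2" for r
  proof -
    have "0 \<le> qform A (w + axis i (complex_of_real r * A $ i $ j))"
      using assms by (simp add: pos_semidef_def)
    then show ?thesis
      using assms by (simp add: pos_semidef_def qform_add_axis Aw inner_of_real_mult)
  qed
  \<comment> \<open>If the entry were nonzero, this \<open>r\<close> would make the right-hand side
    equal to \<open>-1\<close>.\<close>
  from this[of "- (qform A w + 1) / (2 * (cmod (A $ i $ j))\<^sup>2)"] show ?thesis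
    by (cases "A $ i $ j = 0") (simp_all add: field_simps)
qed

text \<open>This is the Schur complement: its form at \<open>w\<close> is the minimum of
  \<open>qform A\<close> over all changes of the \<open>i\<close>-th coordinate of \<open>w\<close>,
  hence nonnegative.\<close>

lemma pos_semidef_pivot:
  assumes "pos_semidef A" "0 < Re (A $ i $ i)"
  shows "pos_semidef (A - (1 / Re (A $ i $ i)) *\<^sub>R outer (column i A))"
    (is "pos_semidef (A - (1 / ?r) *\<^sub>R _)")
proof -
  have herm: "hermitian A"
    using assms by (simp add: pos_semidef_def)
  have "0 \<le> qform (A - (1 / ?r) *\<^sub>R outer (column i A)) w" for w
  proof -
    define z where "z = (A *v w) $ i"
    have "(\<Sum>j\<in>UNIV. cnj (w $ j) * column i A $ j) = cnj z"
      by (simp add: z_def matrix_vector_mult_def column_def mult.commute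
          flip: hermitian_nth[OF herm, of _ i])
    then have "qform (outer (column i A)) w = (cmod z)\<^sup>2"
      by (simp add: qform_outer)
    \<comment> \<open>The shift is the minimiser of the quadratic polynomial from
      \<open>qform_add_axis\<close>, found by completing the square.\<close>
    moreover have "qform A (w + axis i (complex_of_real (- 1 / ?r) * z)) =
        qform A w - (cmod z)\<^sup>2 / ?r"
    proof -
      have "qform A (w + axis i (complex_of_real (- 1 / ?r) * z)) =
          qform A w + 2 * (- 1 / ?r) * (cmod z)\<^sup>2 + (1 / ?r)\<^sup>2 * (cmod z)\<^sup>2 * ?r"
        unfolding qform_add_axis[OF herm] z_def[symmetric] inner_of_real_mult norm_mult
          norm_of_real power_mult_distrib by (simp add: power_divide)
      also have "\<dots> = qform A w - (cmod z)\<^sup>2 / ?r"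
        using assms by (simp add: power2_eq_square field_simps)
      finally show ?thesis .
    qed
    moreover have "0 \<le> qform A (w + axis i (complex_of_real (- 1 / ?r) * z))"
      using assms unfolding pos_semidef_def by blast
    ultimately show ?thesis
      by (simp add: qform_diff qform_scaleR)
  qed
  then show ?thesis
    using herm unfolding pos_semidef_def
    by (blast intro: hermitian_diff hermitian_scaleR hermitian_outer)
qed

text \<open>One step of Cholesky elimination splits off a rank-one matrix from \<open>B\<close> and kills a
  diagonal entry; on rank-one matrices the claim is positivity of \<open>qform A\<close>.\<close>

lemma pos_semidef_inner_nonneg:
  assumes "pos_semidef A" "pos_semidef B"
  shows "0 \<le> A \<bullet> B"
  using assms(2)
proof (induction "card {i. Re (B $ i $ i) \<noteq> 0}" arbitrary: B rule: less_induct)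
  case less
  show ?case
  proof (cases "\<forall>i. Re (B $ i $ i) = 0")
    case True
    then have "B = 0"
      using pos_semidef_row_eq_0[OF less.prems] by (simp add: vec_eq_iff)
    then show ?thesis by simp
  next
    case False
    then obtain i where "Re (B $ i $ i) \<noteq> 0" by blast
    with pos_semidef_diag_nonneg[OF less.prems, of i] have pos: "0 < Re (B $ i $ i)"
      by simp
    define r where "r = Re (B $ i $ i)"
    define C where "C = B - (1 / r) *\<^sub>R outer (column i B)"
    have C: "pos_semidef C"
      unfolding C_def r_def by (rule pos_semidef_pivot[OF less.prems pos])
    have herm: "hermitian B"
      using less.prems by (simp add: pos_semidef_def)
    have diag: "Re (C $ j $ j) = Re (B $ j $ j) - (cmod (B $ j $ i))\<^sup>2 / r" for j
      by (simp add: C_def outer_def column_def del: of_real_power flip: complex_norm_square)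
    have "Im (B $ i $ i) = 0"
      using hermitian_nth[OF herm, of i i] by (simp add: complex_eq_iff)
    then have "Re (C $ i $ i) = 0"
      using pos by (simp add: diag r_def cmod_eq_Re power2_eq_square)
    \<comment> \<open>A zero diagonal entry has a zero row, so elimination leaves it at zero.
      Together with the cleared pivot this makes the count of nonzero diagonal entries drop
      strictly.\<close>
    moreover have "Re (C $ j $ j) = 0" if "Re (B $ j $ j) = 0" for j
      using pos_semidef_row_eq_0[OF less.prems that] that by (simp add: diag)
    ultimately have "{j. Re (C $ j $ j) \<noteq> 0} \<subset> {j. Re (B $ j $ j) \<noteq> 0}"
      using pos by force
    then have "card {j. Re (C $ j $ j) \<noteq> 0} < card {j. Re (B $ j $ j) \<noteq> 0}"
      by (intro psubset_card_mono) auto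
    then have "0 \<le> A \<bullet> C"
      using less.hyps C by blast
    moreover have "A \<bullet> B = A \<bullet> C + (1 / r) * qform A (column i B)"
      by (simp add: C_def inner_diff_right qform_eq_inner_outer)
    moreover have "0 \<le> (1 / r) * qform A (column i B)"
      using assms(1) pos by (simp add: pos_semidef_def r_def)
    ultimately show ?thesis by linarith
  qed
qed

text \<open>By \<open>qform_le\<close> the matrix \<open>norm A *\<^sub>R mat 1 - A\<close> is
  semidefinite; pairing it with \<open>A\<close> and cancelling \<open>norm A\<close> gives the
  bound.\<close>

lemma norm_le_trace:
  assumes "pos_semidef A"
  shows "norm A \<le> Re (trace A)"
proof -
  have "pos_semidef (norm A *\<^sub>R mat 1 - A)"
    using assms qform_le[of A]
    by (simp add: pos_semidef_def hermitian_diff hermitian_scaleR hermitian_mat_1 qform_diff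
        qform_scaleR qform_mat_1)
  from pos_semidef_inner_nonneg[OF this assms]
  have "norm A * norm A \<le> norm A * Re (trace A)"
    by (simp add: inner_diff_left inner_mat_1 flip: power2_norm_eq_inner power2_eq_square)
  then show ?thesis
    using pos_semidef_diag_nonneg[OF assms]
    by (cases "A = 0") (simp_all add: trace_def)
qed

text \<open>By compactness the form of \<open>D\<close> has a minimum \<open>e > 0\<close> on the
  unit sphere. Then \<open>D - e *\<^sub>R mat 1\<close> is semidefinite, so the pairing is at least
  \<open>e\<close> times the trace of \<open>A\<close>, which is positive.\<close>

lemma pos_def_inner_pos:
  assumes "pos_def D" "pos_semidef A" "A \<noteq> 0"
  shows "0 < D \<bullet> A"
proof -
  have "continuous_on (sphere 0 1) (qform D)"
    unfolding qform_eq_inner_mult matrix_vector_mult_def by (intro continuous_intros)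
  then obtain u where u: "u \<in> sphere 0 1" "\<And>v. v \<in> sphere 0 1 \<Longrightarrow> qform D u \<le> qform D v"
    using continuous_attains_inf[of "sphere 0 1" "qform D"] by auto
  define e where "e = qform D u"
  have "u \<noteq> 0" using u(1) by auto
  then have e: "0 < e"
    using assms(1) by (simp add: pos_def_def e_def)
  \<comment> \<open>The form is homogeneous of degree two, so the bound on the sphere extends to all
    vectors by normalising.\<close>
  have "e * (norm v)\<^sup>2 \<le> qform D v" for v
  proof (cases "v = 0")
    case False
    have "outer ((1 / norm v) *\<^sub>R v) = (1 / (norm v)\<^sup>2) *\<^sub>R outer v"
      by (simp add: vec_eq_iff outer_def power2_eq_square)
    then have "qform D ((1 / norm v) *\<^sub>R v) = qform D v / (norm v)\<^sup>2"
      by (simp add: qform_eq_inner_outer)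
    moreover have "e \<le> qform D ((1 / norm v) *\<^sub>R v)"
      unfolding e_def using False by (intro u(2)) simp
    ultimately have "e \<le> qform D v / (norm v)\<^sup>2"
      by simp
    then show ?thesis
      using False by (subst (asm) pos_le_divide_eq) simp_all
  qed (simp add: qform_eq_inner_mult)
  then have "pos_semidef (D - e *\<^sub>R mat 1)"
    using assms(1) by (simp add: pos_semidef_def pos_def_def hermitian_diff hermitian_scaleR
        hermitian_mat_1 qform_diff qform_scaleR qform_mat_1)
  from pos_semidef_inner_nonneg[OF this assms(2)] have "e * Re (trace A) \<le> D \<bullet> A"
    by (simp add: inner_diff_left inner_mat_1)
  moreover have "0 < Re (trace A)"
    using norm_le_trace[OF assms(2)] assms(3) by (smt (verit) zero_less_norm_iff)
  ultimately show ?thesis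
    using e by (smt (verit) mult_pos_pos)
qed

section \<open>Density matrices and the dual of an SDG\<close>

lemma density_matrices_nonzero: "R \<in> density_matrices \<Longrightarrow> R \<noteq> 0"
  by (auto simp: density_matrices_def trace_def)

lemma inner_mat_1_density: "R \<in> density_matrices \<Longrightarrow> mat 1 \<bullet> R = 1"
  by (simp add: density_matrices_def inner_mat_1)

lemma closed_density_matrices: "closed (density_matrices :: (complex ^ 'n ^ 'n) set)"
proof -
  have "closed {R :: complex ^ 'n ^ 'n. mat_adjoint R = R}"
    unfolding mat_adjoint_def by (intro closed_Collect_eq continuous_intros)
  moreover have "closed {R :: complex ^ 'n ^ 'n. \<forall>v. 0 \<le> qform R v}"
    unfolding qform_eq_inner_outer by (intro closed_Collect_all closed_Collect_le continuous_intros)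
  moreover have "closed {R :: complex ^ 'n ^ 'n. trace R = 1}"
    unfolding trace_def by (intro closed_Collect_eq continuous_intros)
  ultimately show ?thesis
    unfolding density_matrices_def pos_semidef_def hermitian_def
    by (simp add: closed_Collect_conj)
qed

lemma convex_density_matrices: "convex (density_matrices :: (complex ^ 'n ^ 'n) set)"
proof (rule convexI)
  fix A B :: "complex ^ 'n ^ 'n" and u v :: real
  assume "A \<in> density_matrices" "B \<in> density_matrices" and uv: "0 \<le> u" "0 \<le> v" "u + v = 1"
  moreover have "trace (u *\<^sub>R A + v *\<^sub>R B) = u *\<^sub>R trace A + v *\<^sub>R trace B"
    by (simp add: trace_def sum.distrib scaleR_sum_right)
  ultimately show "u *\<^sub>R A + v *\<^sub>R B \<in> density_matrices"
    by (simp add: density_matrices_def pos_semidef_add pos_semidef_scaleR flip: scaleR_left_distrib)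
qed

lemma bounded_density_matrices: "bounded (density_matrices :: (complex ^ 'n ^ 'n) set)"
proof -
  have "norm R \<le> 1" if "R \<in> density_matrices" for R :: "complex ^ 'n ^ 'n"
    using that norm_le_trace[of R] by (simp add: density_matrices_def)
  then show ?thesis
    unfolding bounded_iff by blast
qed

text \<open>To get strictness from the weak inequality, split a non-semidefinite \<open>G\<close> by
  (S3) as \<open>(G - D) + D\<close>: the first summand pairs nonnegatively, the second positively.
  The weak form shows the dual as an intersection of closed half-spaces with the density
  matrices.\<close>

lemma credal_of_eq:
  assumes "sdg K"
  shows "credal_of K = {R \<in> density_matrices. \<forall>G\<in>K. 0 \<le> G \<bullet> R}"
proof (intro equalityI subsetI)
  fix R assume "R \<in> credal_of K"
  then show "R \<in> {R \<in> density_matrices. \<forall>G\<in>K. 0 \<le> G \<bullet> R}"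
    by (auto simp: credal_of_def hs_inner_eq_inner pos_semidef_nonzero_def density_matrices_def
        intro: pos_semidef_inner_nonneg less_imp_le)
next
  fix R assume R: "R \<in> {R \<in> density_matrices. \<forall>G\<in>K. 0 \<le> G \<bullet> R}"
  have "pos_semidef_nonzero G \<or> 0 < G \<bullet> R" if "G \<in> K" for G
  proof (cases "pos_semidef_nonzero G")
    case False
    with assms that obtain D where D: "pos_def D" "G - D \<in> K"
      unfolding sdg_def by blast
    have "0 < D \<bullet> R"
      using D(1) R density_matrices_nonzero[of R]
      by (intro pos_def_inner_pos) (auto simp: density_matrices_def)
    moreover have "0 \<le> (G - D) \<bullet> R"
      using R D(2) by blast
    ultimately show ?thesis
      by (simp add: inner_diff_left)
  qed simp
  with R show "R \<in> credal_of K"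
    by (simp add: credal_of_def hs_inner_eq_inner)
qed

section \<open>Separating a Hermitian matrix from an SDG\<close>

text \<open>Test with the skew-Hermitian matrix \<open>A - mat_adjoint A\<close>: taking adjoints
  flips the sign of the pairing, so this matrix is orthogonal to itself.\<close>

lemma hermitian_if_orthogonal:
  assumes "\<And>X. mat_adjoint X = - X \<Longrightarrow> A \<bullet> X = 0"
  shows "hermitian A"
proof -
  define X where "X = A - mat_adjoint A"
  have X: "mat_adjoint X = - X"
    by (simp add: X_def mat_adjoint_diff)
  have "A \<bullet> X = 0"
    by (rule assms[OF X])
  moreover have "mat_adjoint A \<bullet> X = - (A \<bullet> X)"
    using inner_mat_adjoint[of A X] by (simp add: X)
  ultimately have "X \<bullet> X = 0"
    by (simp add: X_def inner_diff_left)
  then show ?thesis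
    by (simp add: X_def hermitian_def)
qed

lemma affine_nonneg_imp_slope_0:
  fixes a b :: real
  assumes "\<And>t. 0 \<le> a + t * b"
  shows "b = 0"
  \<comment> \<open>For nonzero \<open>b\<close> the affine function takes the value
    \<open>-1\<close> at this point.\<close>
  using assms[of "- (a + 1) / b"] by (cases "b = 0") simp_all

text \<open>For a functional bounded below along an open ray: large \<open>t\<close> excludes a
  negative value \<open>a\<close>, and \<open>t\<close> tending to zero excludes a positive bound
  \<open>c\<close>.\<close>

lemma cone_lower_bound:
  fixes a c :: real
  assumes "\<And>t. 0 < t \<Longrightarrow> c \<le> t * a"
  shows "0 \<le> a" "c \<le> 0"
proof -
  show "0 \<le> a"
  proof (rule ccontr)
    assume "\<not> 0 \<le> a"
    \<comment> \<open>At this \<open>t\<close> the product \<open>t * a\<close> is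
      \<open>- (\<bar>c\<bar> + 1)\<close>, which lies below \<open>c\<close>.\<close>
    then have "0 < (\<bar>c\<bar> + 1) / - a"
      by (intro divide_pos_pos) simp_all
    from assms[OF this] \<open>\<not> 0 \<le> a\<close> show False
      by simp
  qed
  show "c \<le> 0"
  proof (rule field_le_epsilon)
    fix e :: real assume "0 < e"
    then have "c \<le> (e / (\<bar>a\<bar> + 1)) * a"
      by (intro assms) simp
    also have "\<dots> \<le> (e / (\<bar>a\<bar> + 1)) * (\<bar>a\<bar> + 1)"
      using \<open>0 < e\<close> by (intro mult_left_mono) simp_all
    also have "\<dots> = e"
      using abs_ge_zero[of a] by simp
    finally show "c \<le> 0 + e" by simp
  qed
qed

text \<open>Pulling \<open>K\<close> back along \<open>X \<mapsto> X + X\<^sup>*\<close> gives a convex cone in the space of all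
  matrices that is invariant under skew-Hermitian translations, so the normal of a separating
  hyperplane is automatically Hermitian.\<close>

lemma sdg_separation:
  fixes K :: "(complex ^ 'n ^ 'n) set"
  assumes "sdg K" "hermitian G" "G \<notin> K"
  obtains R where "R \<in> credal_of K" "G \<bullet> R \<le> 0"
proof -
  have K_add: "\<And>A B. A \<in> K \<Longrightarrow> B \<in> K \<Longrightarrow> A + B \<in> K"
    and K_scale: "\<And>A r. A \<in> K \<Longrightarrow> 0 < r \<Longrightarrow> r *\<^sub>R A \<in> K"
    and K_psd: "\<And>A. pos_semidef A \<Longrightarrow> A \<noteq> 0 \<Longrightarrow> A \<in> K"
    and K_herm: "\<And>A. A \<in> K \<Longrightarrow> hermitian A"
    using assms(1) by (auto simp: sdg_def pos_semidef_nonzero_def)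
  define S where "S = {X. X + mat_adjoint X \<in> K}"
  have S_add: "A + B \<in> S" if "A \<in> S" "B \<in> S" for A B
    using K_add[of "A + mat_adjoint A" "B + mat_adjoint B"] that
    by (simp add: S_def mat_adjoint_add algebra_simps)
  have S_scale: "r *\<^sub>R A \<in> S" if "A \<in> S" "0 < r" for A r
    using K_scale[of "A + mat_adjoint A" r] that
    by (simp add: S_def mat_adjoint_scaleR scaleR_right_distrib)
  \<comment> \<open>On Hermitian matrices the pullback map is doubling, which the cone property
    absorbs.\<close>
  have S_herm: "A \<in> S \<longleftrightarrow> A \<in> K" if "hermitian A" for A
  proof -
    have "A + mat_adjoint A = 2 *\<^sub>R A"
      using that by (simp add: hermitian_def scaleR_2)
    then show ?thesis
      using K_scale[of A 2] K_scale[of "2 *\<^sub>R A" "1/2"] by (auto simp: S_def)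
  qed
  have "pos_semidef (mat 1 :: complex ^ 'n ^ 'n)"
    by (simp add: pos_semidef_def hermitian_mat_1 qform_mat_1)
  moreover have "mat 1 \<noteq> (0 :: complex ^ 'n ^ 'n)"
    by (simp add: vec_eq_iff mat_def)
  ultimately have one_S: "mat 1 \<in> S"
    by (simp add: S_herm hermitian_mat_1 K_psd)
  have "convex S"
  proof (rule convexI)
    fix A B and u v :: real
    assume "A \<in> S" "B \<in> S" "0 \<le> u" "0 \<le> v" "u + v = 1"
    then show "u *\<^sub>R A + v *\<^sub>R B \<in> S"
      \<comment> \<open>Zero weights are treated apart because \<open>S\<close> is closed under
        positive factors only.\<close>
      by (cases "u = 0"; cases "v = 0") (simp_all add: S_add S_scale)
  qed
  moreover have "{G} \<inter> S = {}"
    using assms(2,3) by (simp add: S_herm)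
  \<comment> \<open>The separation is only weak, since \<open>G\<close> may lie on the boundary;
    this suffices for the nonpositive pairing that is sought.\<close>
  ultimately obtain A b where A: "A \<noteq> 0" "A \<bullet> G \<le> b" "\<And>X. X \<in> S \<Longrightarrow> b \<le> A \<bullet> X"
    using separating_hyperplane_sets[of "{G}" S] one_S by auto
  have scaled: "b \<le> t * (A \<bullet> X)" if "X \<in> S" "0 < t" for t X
    using A(3)[OF S_scale[OF that]] by simp
  have A_S: "0 \<le> A \<bullet> X" if "X \<in> S" for X
    using cone_lower_bound(1) scaled[OF that] by blast
  have "b \<le> 0"
    using cone_lower_bound(2) scaled[OF one_S] by blast
  have "hermitian A"
  proof (rule hermitian_if_orthogonal)
    fix X :: "complex ^ 'n ^ 'n" assume X: "mat_adjoint X = - X"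
    \<comment> \<open>The skew part cancels in \<open>X + mat_adjoint X\<close>, so a whole line
      lies in \<open>S\<close>; a functional nonnegative on it is constant along it.\<close>
    have "mat 1 + t *\<^sub>R X \<in> S" for t
      using one_S by (simp add: S_def mat_adjoint_add mat_adjoint_scaleR X)
    from A_S[OF this] have "0 \<le> A \<bullet> mat 1 + t * (A \<bullet> X)" for t
      by (simp add: inner_add_right)
    then show "A \<bullet> X = 0"
      by (rule affine_nonneg_imp_slope_0)
  qed
  moreover have "0 \<le> qform A v" for v
  proof (cases "outer v = 0")
    case False
    then have "outer v \<in> S"
      by (simp add: S_herm hermitian_outer K_psd pos_semidef_outer)
    then show ?thesis
      by (simp add: qform_eq_inner_outer A_S)
  qed (simp add: qform_eq_inner_outer)
  ultimately have psd: "pos_semidef A"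
    by (simp add: pos_semidef_def)
  define t where "t = Re (trace A)"
  have t: "0 < t"
    using norm_le_trace[OF psd] A(1) unfolding t_def by (smt (verit) zero_less_norm_iff)
  \<comment> \<open>The condition \<open>trace R = 1\<close> is an equation of complex numbers, so
    the trace must be shown real before normalising.\<close>
  have "Im (A $ i $ i) = 0" for i
    using hermitian_nth[OF \<open>hermitian A\<close>, of i i] by (simp add: complex_eq_iff)
  then have tr: "trace A = complex_of_real t"
    by (simp add: t_def trace_def complex_eq_iff)
  define R where "R = (1 / t) *\<^sub>R A"
  have "trace R = (1 / t) *\<^sub>R trace A"
    by (simp add: R_def trace_def scaleR_sum_right)
  then have "trace R = 1"
    using t by (simp add: tr scaleR_conv_of_real)
  then have "R \<in> density_matrices"
    using psd t by (simp add: density_matrices_def R_def pos_semidef_scaleR)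
  moreover have "0 \<le> H \<bullet> R" if "H \<in> K" for H
    using A_S[of H] t that S_herm K_herm by (simp add: R_def inner_commute)
  ultimately have "R \<in> credal_of K"
    by (simp add: credal_of_eq[OF assms(1)])
  moreover have "G \<bullet> R \<le> 0"
    using A(2) \<open>b \<le> 0\<close> t by (simp add: R_def inner_commute divide_nonpos_pos)
  ultimately show ?thesis
    by (rule that)
qed

section \<open>The two double-dual identities\<close>

lemma gambles_of_credal_of:
  assumes "sdg K"
  shows "gambles_of (credal_of K) = K"
proof (intro equalityI subsetI)
  fix G assume G: "G \<in> gambles_of (credal_of K)"
  show "G \<in> K"
  proof (rule ccontr)
    assume "G \<notin> K"
    \<comment> \<open>By (S2) the semidefinite part of \<open>gambles_of\<close> lies in
      \<open>K\<close>, so \<open>G\<close> must come from the strictly positive part.\<close>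
    moreover from this have "\<not> pos_semidef_nonzero G"
      using assms by (auto simp: sdg_def)
    moreover from this G have "hermitian G"
      by (simp add: gambles_of_def)
    ultimately obtain R where "R \<in> credal_of K" "G \<bullet> R \<le> 0"
      using sdg_separation[OF assms] by blast
    with G \<open>\<not> pos_semidef_nonzero G\<close> show False
      by (auto simp: gambles_of_def hs_inner_eq_inner dest!: bspec)
  qed
next
  fix G assume "G \<in> K"
  then show "G \<in> gambles_of (credal_of K)"
    using assms by (auto simp: gambles_of_def credal_of_def sdg_def)
qed

lemma credal_of_gambles_of:
  assumes "closed_convex_density_set M"
  shows "credal_of (gambles_of M) = M"
proof (intro equalityI subsetI)
  fix R assume R: "R \<in> credal_of (gambles_of M)"
  then have R_dens: "R \<in> density_matrices"
    by (simp add: credal_of_def)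
  show "R \<in> M"
  proof (rule ccontr)
    assume "R \<notin> M"
    then obtain A b where A: "A \<bullet> R < b" "\<And>X. X \<in> M \<Longrightarrow> b < A \<bullet> X"
      using assms separating_hyperplane_closed_point[of M R]
      unfolding closed_convex_density_set_def by blast
    \<comment> \<open>The Hermitian part of \<open>A\<close> pairs with Hermitian matrices as
      \<open>A\<close> does, and the multiple of the identity subtracts exactly \<open>b\<close> on
      matrices of trace one.\<close>
    define G where "G = (1/2) *\<^sub>R (A + mat_adjoint A) - b *\<^sub>R mat 1"
    have herm: "hermitian G"
      unfolding G_def
      by (intro hermitian_diff hermitian_scaleR hermitian_add_mat_adjoint hermitian_mat_1)
    have G: "G \<bullet> X = A \<bullet> X - b" if "X \<in> density_matrices" for X
    proof -
      have "mat_adjoint A \<bullet> X = A \<bullet> X"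
        using inner_mat_adjoint[of A X] that
        by (simp add: density_matrices_def pos_semidef_def hermitian_def)
      then show ?thesis
        using that by (simp add: G_def inner_diff_left inner_add_left inner_mat_1_density)
    qed
    have "0 < G \<bullet> X" if "X \<in> M" for X
      using A(2)[OF that] G[of X] that assms by (auto simp: closed_convex_density_set_def)
    then have "G \<in> gambles_of M"
      using herm by (simp add: gambles_of_def hs_inner_eq_inner)
    then have "pos_semidef_nonzero G \<or> 0 < G \<bullet> R"
      using R by (auto simp: credal_of_def hs_inner_eq_inner)
    \<comment> \<open>If \<open>G\<close> happens to be semidefinite, only the weak inequality is
      available; it already contradicts \<open>A \<bullet> R < b\<close>.\<close>
    then have "0 \<le> G \<bullet> R"
      using R_dens by (auto simp: pos_semidef_nonzero_def density_matrices_def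
          intro: pos_semidef_inner_nonneg)
    then show False
      using A(1) G[OF R_dens] by simp
  qed
next
  fix R assume "R \<in> M"
  then show "R \<in> credal_of (gambles_of M)"
    using assms by (auto simp: credal_of_def gambles_of_def closed_convex_density_set_def)
qed

section \<open>Closed convex sets of density matrices and SDGs in bijection\<close>

lemma sdg_gambles_of:
  fixes M :: "(complex ^ 'n ^ 'n) set"
  assumes "closed_convex_density_set M"
  shows "sdg (gambles_of M)"
proof -
  have M: "M \<subseteq> density_matrices" "M \<noteq> {}" "closed M"
    using assms by (auto simp: closed_convex_density_set_def)
  have psd: "pos_semidef R" if "R \<in> M" for R
    using that M by (auto simp: density_matrices_def)
  have inner_nonneg: "0 \<le> G \<bullet> R" if "G \<in> gambles_of M" "R \<in> M" for G R
    using that psd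
    by (auto simp: gambles_of_def hs_inner_eq_inner pos_semidef_nonzero_def
        intro: pos_semidef_inner_nonneg less_imp_le)
  have "compact M"
    using M bounded_subset[OF bounded_density_matrices] by (simp add: compact_eq_bounded_closed)
  have herm: "hermitian G" if "G \<in> gambles_of M" for G
    using that by (auto simp: gambles_of_def pos_semidef_nonzero_def pos_semidef_def)
  have add: "G + H \<in> gambles_of M" if GH: "G \<in> gambles_of M" "H \<in> gambles_of M" for G H
  proof (cases "pos_semidef_nonzero G \<and> pos_semidef_nonzero H")
    case True
    \<comment> \<open>The semidefinite cone contains no line: \<open>H = - G\<close> would give
      \<open>0 \<le> - (G \<bullet> G)\<close> by self-duality.\<close>
    have "G + H \<noteq> 0"
    proof
      assume "G + H = 0"
      then have "H = - G"
        by (simp add: eq_neg_iff_add_eq_0 add.commute)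
      moreover have "0 \<le> G \<bullet> H"
        using True by (simp add: pos_semidef_nonzero_def pos_semidef_inner_nonneg)
      ultimately have "G \<bullet> G = 0"
        using inner_ge_zero[of G] by simp
      then show False
        using True by (simp add: pos_semidef_nonzero_def)
    qed
    then show ?thesis
      using True by (simp add: gambles_of_def pos_semidef_nonzero_def pos_semidef_add)
  next
    case False
    \<comment> \<open>At least one summand is strictly positive on \<open>M\<close>, and the other
      is nonnegative there.\<close>
    have "0 < (G + H) \<bullet> R" if "R \<in> M" for R
      using False GH inner_nonneg[OF GH(1) that] inner_nonneg[OF GH(2) that] that
      by (auto simp: gambles_of_def hs_inner_eq_inner inner_add_left
          intro: add_pos_nonneg add_nonneg_pos)
    then show ?thesis
      using herm[OF GH(1)] herm[OF GH(2)]
      by (simp add: gambles_of_def hs_inner_eq_inner hermitian_add)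
  qed
  have scale: "r *\<^sub>R G \<in> gambles_of M" if "G \<in> gambles_of M" "0 < r" for G r
    using that
    by (auto simp: gambles_of_def hs_inner_eq_inner pos_semidef_nonzero_def
        pos_semidef_scaleR hermitian_scaleR)
  \<comment> \<open>Any element of the nonempty \<open>M\<close> pairs to zero with
    \<open>0\<close>, violating strict positivity.\<close>
  have zero: "0 \<notin> gambles_of M"
    using M(2) by (auto simp: gambles_of_def hs_inner_eq_inner pos_semidef_nonzero_def)
  have open_cond: "\<exists>D. pos_def D \<and> G - D \<in> gambles_of M"
    if "G \<in> gambles_of M" "\<not> pos_semidef_nonzero G" for G
  proof -
    have pos: "\<And>R. R \<in> M \<Longrightarrow> 0 < G \<bullet> R"
      using that by (simp add: gambles_of_def hs_inner_eq_inner)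
    have "continuous_on M (\<lambda>R. G \<bullet> R)"
      by (intro continuous_intros)
    then obtain R0 where R0: "R0 \<in> M" "\<And>R. R \<in> M \<Longrightarrow> G \<bullet> R0 \<le> G \<bullet> R"
      using continuous_attains_inf[OF \<open>compact M\<close> M(2)] by blast
    \<comment> \<open>Half the minimum of \<open>G\<close> over the compact set \<open>M\<close>:
      subtracting it leaves at least the other half on every density matrix in
      \<open>M\<close>.\<close>
    define D :: "complex ^ 'n ^ 'n" where "D = (G \<bullet> R0 / 2) *\<^sub>R mat 1"
    have "pos_def D"
      using pos[OF R0(1)]
      by (simp add: pos_def_def D_def hermitian_scaleR hermitian_mat_1 qform_scaleR qform_mat_1)
    moreover have "0 < (G - D) \<bullet> R" if "R \<in> M" for R
    proof -
      have "(G - D) \<bullet> R = G \<bullet> R - G \<bullet> R0 / 2"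
        using that M(1) inner_mat_1_density[of R] by (auto simp: D_def inner_diff_left)
      then show ?thesis
        using R0(2)[OF that] pos[OF R0(1)] by linarith
    qed
    then have "G - D \<in> gambles_of M"
      using herm[OF that(1)]
      by (simp add: gambles_of_def hs_inner_eq_inner D_def hermitian_diff hermitian_scaleR
          hermitian_mat_1)
    ultimately show ?thesis by blast
  qed
  show ?thesis
    unfolding sdg_def using herm add scale zero open_cond
    by (intro conjI) (blast | simp add: gambles_of_def)+
qed

lemma closed_convex_credal_of:
  fixes K :: "(complex ^ 'n ^ 'n) set"
  assumes "sdg K"
  shows "closed_convex_density_set (credal_of K)"
proof -
  have eq: "credal_of K = density_matrices \<inter> (\<Inter>G\<in>K. {R. 0 \<le> G \<bullet> R})"
    by (auto simp: credal_of_eq[OF assms])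
  have "closed (credal_of K)"
    unfolding eq by (intro closed_Int closed_INT ballI closed_density_matrices closed_Collect_le
        continuous_intros)
  moreover have "convex (credal_of K)"
    unfolding eq by (intro convex_Int convex_INT convex_density_matrices convex_halfspace_ge)
  moreover have "credal_of K \<noteq> {}"
    \<comment> \<open>The zero matrix is Hermitian and outside \<open>K\<close>, so separating it
      produces an element of the dual.\<close>
    using sdg_separation[OF assms, of 0] assms by (force simp: sdg_def hermitian_def vec_eq_iff)
  ultimately show ?thesis
    by (simp add: closed_convex_density_set_def credal_of_def)
qed

theorem mainTheorem1:
  shows "(\<forall>K :: (complex ^ 'n ^ 'n) set. sdg K \<longrightarrow> gambles_of (credal_of K) = K) \<and>
         (\<forall>M :: (complex ^ 'n ^ 'n) set. quantum_credal_set M \<longrightarrow> credal_of (gambles_of M) = M) \<and>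
         bij_betw credal_of {K :: (complex ^ 'n ^ 'n) set. sdg K} {M. closed_convex_density_set M} \<and>
         bij_betw gambles_of {M :: (complex ^ 'n ^ 'n) set. closed_convex_density_set M} {K. sdg K}"
proof (intro conjI allI impI)
  fix M :: "(complex ^ 'n ^ 'n) set"
  assume "quantum_credal_set M"
  \<comment> \<open>A quantum credal set is the dual of an SDG, hence nonempty, closed and convex,
    and the identity for such sets applies.\<close>
  then show "credal_of (gambles_of M) = M"
    by (auto simp: quantum_credal_set_def closed_convex_credal_of credal_of_gambles_of)
next
  show "bij_betw credal_of {K :: (complex ^ 'n ^ 'n) set. sdg K} {M. closed_convex_density_set M}"
    by (rule bij_betw_byWitness[where f' = gambles_of])
      (auto simp: gambles_of_credal_of credal_of_gambles_of sdg_gambles_of closed_convex_credal_of)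
next
  show "bij_betw gambles_of {M :: (complex ^ 'n ^ 'n) set. closed_convex_density_set M} {K. sdg K}"
    by (rule bij_betw_byWitness[where f' = credal_of])
      (auto simp: gambles_of_credal_of credal_of_gambles_of sdg_gambles_of closed_convex_credal_of)
qed (rule gambles_of_credal_of)

end
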